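(* Let $(X,d)$ be a metric space. Then $X$ admits a coarse embedding into a Hilbert space if and only if there exist non-decreasing functions $\rho_1,\rho_2\colon[0,\infty)\to[0,\infty)$ such that $\lim_{t\to\infty}\rho_1(t)=\infty$ and for every finite subset $A\subset X$ there exists a map $f_A\colon A\to\ell_2$ satisfying $$\rho_1(d(x,y))\le\Vert f_A(x)-f_A(y)\Vert\le\rho_2(d(x,y))$$ for every $x,y\in A$.
   Context: A (not necessarily continuous) map $f\colon X\to Y$ between metric spaces $(X,d_X)$ and $(Y,d_Y)$ is a coarse embedding if there exist non-decreasing functions $\sigma_1,\sigma_2\colon[0,\infty)\to[0,\infty)$ such that $\sigma_1(d_X(x,y))\le d_Y(f(x),f(y))\le\sigma_2(d_X(x,y))$ for all $x,y\in X$ and $\lim_{t\to\infty}\sigma_1(t)=+\infty$. All Hilbert spaces (including $\ell_2$) are real; a Hilbert space is not assumed to be separable. *)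

theory Defs
  imports "HOL-Analysis.Analysis"
begin

text \<open>
  HOL cannot quantify over types inside a formula, so a Hilbert space is a carrier set in an
  arbitrary type together with its operations; this makes \<open>there is a Hilbert space\<close> expressible.
\<close>

record 'h inner_structure =
  vecs :: "'h set"
  vadd :: "'h \<Rightarrow> 'h \<Rightarrow> 'h"
  vzero :: 'h
  vscale :: "real \<Rightarrow> 'h \<Rightarrow> 'h"
  vinner :: "'h \<Rightarrow> 'h \<Rightarrow> real"

locale real_inner_space =
  fixes H :: "'h inner_structure"
  assumes add_closed: "\<lbrakk>u \<in> vecs H; v \<in> vecs H\<rbrakk> \<Longrightarrow> vadd H u v \<in> vecs H"
    and zero_closed: "vzero H \<in> vecs H"
    and scale_closed: "u \<in> vecs H \<Longrightarrow> vscale H a u \<in> vecs H"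
    and add_assoc: "\<lbrakk>u \<in> vecs H; v \<in> vecs H; w \<in> vecs H\<rbrakk>
      \<Longrightarrow> vadd H (vadd H u v) w = vadd H u (vadd H v w)"
    and add_commute: "\<lbrakk>u \<in> vecs H; v \<in> vecs H\<rbrakk> \<Longrightarrow> vadd H u v = vadd H v u"
    and add_zero: "u \<in> vecs H \<Longrightarrow> vadd H u (vzero H) = u"
    and add_inverse: "u \<in> vecs H \<Longrightarrow> \<exists>v\<in>vecs H. vadd H u v = vzero H"
    and scale_add_right: "\<lbrakk>u \<in> vecs H; v \<in> vecs H\<rbrakk>
      \<Longrightarrow> vscale H a (vadd H u v) = vadd H (vscale H a u) (vscale H a v)"
    and scale_add_left: "u \<in> vecs H
      \<Longrightarrow> vscale H (a + b) u = vadd H (vscale H a u) (vscale H b u)"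
    and scale_scale: "u \<in> vecs H \<Longrightarrow> vscale H a (vscale H b u) = vscale H (a * b) u"
    and scale_one: "u \<in> vecs H \<Longrightarrow> vscale H 1 u = u"
    and inner_commute: "\<lbrakk>u \<in> vecs H; v \<in> vecs H\<rbrakk> \<Longrightarrow> vinner H u v = vinner H v u"
    and inner_add_left: "\<lbrakk>u \<in> vecs H; v \<in> vecs H; w \<in> vecs H\<rbrakk>
      \<Longrightarrow> vinner H (vadd H u v) w = vinner H u w + vinner H v w"
    and inner_scale_left: "\<lbrakk>u \<in> vecs H; v \<in> vecs H\<rbrakk>
      \<Longrightarrow> vinner H (vscale H a u) v = a * vinner H u v"
    and inner_ge_zero: "u \<in> vecs H \<Longrightarrow> 0 \<le> vinner H u u"
    and inner_eq_zero: "\<lbrakk>u \<in> vecs H; vinner H u u = 0\<rbrakk> \<Longrightarrow> u = vzero H"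

definition vnorm :: "'h inner_structure \<Rightarrow> 'h \<Rightarrow> real" where
  "vnorm H u = sqrt (vinner H u u)"

definition vdist :: "'h inner_structure \<Rightarrow> 'h \<Rightarrow> 'h \<Rightarrow> real" where
  "vdist H u v = vnorm H (vadd H u (vscale H (- 1) v))"

locale real_hilbert_space = real_inner_space +
  assumes complete: "Metric_space.mcomplete (vecs H) (vdist H)"

lemma real_hilbert_space_UNIV:
  "real_hilbert_space
    \<lparr>vecs = (UNIV :: 'h::{real_inner, complete_space} set),
     vadd = (+), vzero = 0, vscale = (*\<^sub>R), vinner = (\<bullet>)\<rparr>"
proof -
  let ?H = "\<lparr>vecs = (UNIV :: 'h set),
     vadd = (+), vzero = 0, vscale = (*\<^sub>R), vinner = (\<bullet>)\<rparr>"
  have inv: "\<exists>v. u + v = 0" for u :: 'h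
    by (rule exI[of _ "- u"]) simp
  have "vdist ?H = dist"
    by (intro ext) (simp add: vdist_def vnorm_def dist_norm norm_eq_sqrt_inner)
  moreover have "Metric_space.mcomplete (UNIV :: 'h set) dist"
    using complete_UNIV by simp
  ultimately show ?thesis
    by unfold_locales (auto simp: inv algebra_simps inner_commute)
qed

text \<open>The control functions map \<open>[0,\<infinity>)\<close> to \<open>[0,\<infinity>)\<close>; their values at negative arguments are junk.\<close>

definition coarse_embedding ::
    "'a set \<Rightarrow> ('a \<Rightarrow> 'a \<Rightarrow> real) \<Rightarrow> 'b set \<Rightarrow> ('b \<Rightarrow> 'b \<Rightarrow> real) \<Rightarrow> ('a \<Rightarrow> 'b) \<Rightarrow> bool" where
  "coarse_embedding X dX Y dY f \<longleftrightarrow>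
    f \<in> X \<rightarrow> Y \<and>
    (\<exists>\<sigma>1 \<sigma>2. \<sigma>1 \<in> {0..} \<rightarrow> {0..} \<and> mono_on {0..} \<sigma>1 \<and>
      \<sigma>2 \<in> {0..} \<rightarrow> {0..} \<and> mono_on {0..} \<sigma>2 \<and>
      (\<forall>x\<in>X. \<forall>y\<in>X. \<sigma>1 (dX x y) \<le> dY (f x) (f y) \<and> dY (f x) (f y) \<le> \<sigma>2 (dX x y)) \<and>
      filterlim \<sigma>1 at_top (at_top :: real filter))"

text \<open>
  The type argument bounds the underlying sets of the Hilbert spaces considered. Quantifying over
  Hilbert spaces in all types means: a free type variable where such a space is given, and one
  sufficiently large type where it must be found. For a metric space in \<open>'a\<close>, the type
  \<open>'a \<Rightarrow> real\<close> is large enough, up to isometric isomorphism, for the closed linear span of any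
  image of it.
\<close>

definition coarsely_embeds_in_hilbert ::
    "'h itself \<Rightarrow> 'a set \<Rightarrow> ('a \<Rightarrow> 'a \<Rightarrow> real) \<Rightarrow> bool" where
  "coarsely_embeds_in_hilbert _ X d \<longleftrightarrow>
    (\<exists>H :: 'h inner_structure. real_hilbert_space H \<and>
      (\<exists>f. coarse_embedding X d (vecs H) (vdist H) f))"

definition ell2 :: "(nat \<Rightarrow> real) set" where
  "ell2 = {u. summable (\<lambda>n. (u n)\<^sup>2)}"

definition ell2_norm :: "(nat \<Rightarrow> real) \<Rightarrow> real" where
  "ell2_norm u = sqrt (\<Sum>n. (u n)\<^sup>2)"

end

theory Submission
  imports Defs "HOL-Library.Function_Algebras"
begin

text \<open>
  A map of a set into a Hilbert space determines its Gram kernel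
  \<open>K x y = \<langle>f x, f y\<rangle>\<close>, and the distances between the images depend on \<open>K\<close> alone:
  \<open>\<parallel>f x - f y\<parallel>\<^sup>2 = K x x + K y y - 2 K x y\<close>. Conversely every positive semidefinite kernel is the
  Gram kernel of some map. So both sides of the equivalence speak of positive semidefinite kernels
  whose induced distances lie in prescribed intervals, on all of \<open>X\<close> or on each finite subset.

  From a Hilbert space to \<open>\<ell>\<^sub>2\<close>: the Gram kernel of the coarse embedding is positive semidefinite
  (\<open>psd_kernel_gram\<close>), and on a finite set such a kernel is realised by vectors with finitely many
  coordinates (\<open>finite_gram_ell2\<close>), by Cholesky decomposition. The control functions stay the same.

  From finite subsets to a Hilbert space: the embeddings of the finite subsets yield kernels which,
  after a base point has been moved to the origin, are bounded pointwise in terms of the upper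
  control function. They therefore live in a product of compact intervals. Positive semidefiniteness and the
  distance bounds are closed conditions, each on finitely many values of the kernel, so a cluster
  point along the directed set of finite subsets satisfies all of them
  (\<open>psd_kernel_compactness\<close>). The limit kernel is the Gram kernel of the map \<open>x \<mapsto> K x\<close> into
  its reproducing kernel Hilbert space (\<open>rkhs_real_hilbert_space\<close>, \<open>rkhs_feature_dist\<close>). This
  space consists of real functions on the type of \<open>X\<close>, so it fits into \<open>'a \<Rightarrow> real\<close>.

  The reproducing kernel Hilbert space is obtained without a completion. Its squared norm is defined
  as a Legendre transform, \<open>\<parallel>f\<parallel>\<^sup>2 = sup\<^sub>c (2 \<langle>c, f\<rangle> - Q c)\<close>, where \<open>c\<close> ranges over the finite formal
  linear combinations of points and \<open>Q\<close> is the quadratic form of \<open>K\<close>. A linear substitution in \<open>c\<close>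
  gives the parallelogram law, hence an inner product (Jordan and von Neumann), and since the norm is
  a supremum of pointwise continuous expressions, pointwise limits of Cauchy sequences are limits in
  norm.
\<close>

section \<open>Inner products from the parallelogram law\<close>

text \<open>
  The defect \<open>\<psi> r = \<phi> r - r * \<phi> 1\<close> is additive and vanishes on the integers, so it is periodic and its
  bound on the unit interval holds everywhere; an additive function that is bounded everywhere is
  zero. This replaces continuity in the proof that the polar form is homogeneous.
\<close>

lemma additive_bounded_imp_linear:
  fixes \<phi> :: "real \<Rightarrow> real"
  assumes add: "\<And>r s. \<phi> (r + s) = \<phi> r + \<phi> s"
    and bound: "\<And>r. \<bar>r\<bar> \<le> 1 \<Longrightarrow> \<bar>\<phi> r\<bar> \<le> M"
  shows "\<phi> r = r * \<phi> 1"
proof -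
  define \<psi> where "\<psi> r = \<phi> r - r * \<phi> 1" for r
  have \<psi>_add: "\<psi> (r + s) = \<psi> r + \<psi> s" for r s
    by (simp add: \<psi>_def add algebra_simps)
  have zero: "\<psi> 0 = 0" using \<psi>_add[of 0 0] by simp
  have neg: "\<psi> (- r) = - \<psi> r" for r using \<psi>_add[of r "- r"] zero by simp
  have nat_mult: "\<psi> (real n * r) = real n * \<psi> r" for n r
    by (induction n) (simp_all add: zero \<psi>_add algebra_simps)
  have int_zero: "\<psi> (of_int k) = 0" for k
  proof -
    have "\<psi> (real n) = 0" for n using nat_mult[of n 1] by (simp add: \<psi>_def)
    then show ?thesis by (cases k rule: int_cases2) (simp_all add: neg)
  qed
  have bounded: "\<bar>\<psi> s\<bar> \<le> 2 * M" for s
  proof -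
    have "\<psi> s = \<psi> (of_int \<lfloor>s\<rfloor> + frac s)" by (simp add: frac_def)
    also have "\<dots> = \<psi> (frac s)" by (simp only: \<psi>_add int_zero)
    finally have eq: "\<psi> s = \<phi> (frac s) - frac s * \<phi> 1" by (simp add: \<psi>_def)
    have fr: "0 \<le> frac s" "frac s \<le> 1" by (simp_all add: frac_lt_1 less_imp_le)
    have "\<bar>frac s * \<phi> 1\<bar> \<le> 1 * M"
      unfolding abs_mult using fr bound[of 1] by (intro mult_mono) auto
    then show ?thesis using eq bound[of "frac s"] fr by simp
  qed
  have "\<psi> r = 0"
  proof (rule ccontr)
    assume "\<psi> r \<noteq> 0"
    then obtain n where "2 * M < real n * \<bar>\<psi> r\<bar>"
      using reals_Archimedean3[of "\<bar>\<psi> r\<bar>"] by auto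
    also have "\<dots> = \<bar>\<psi> (real n * r)\<bar>" by (simp add: nat_mult abs_mult)
    finally show False using bounded[of "real n * r"] by simp
  qed
  then show ?thesis by (simp add: \<psi>_def)
qed

text \<open>
  \<open>N\<close> plays the role of a squared norm on the subspace \<open>V\<close>. It may vanish on nonzero vectors.
\<close>

locale parallelogram_norm = vector_space scale
  for scale :: "real \<Rightarrow> 'v::ab_group_add \<Rightarrow> 'v" (infixr \<open>\<cdot>\<close> 75) +
  fixes V :: "'v set" and N :: "'v \<Rightarrow> real"
  assumes subspace: "subspace V"
    and N_ge_zero: "v \<in> V \<Longrightarrow> 0 \<le> N v"
    and N_scale: "v \<in> V \<Longrightarrow> N (a \<cdot> v) = a\<^sup>2 * N v"
    and parallelogram: "u \<in> V \<Longrightarrow> v \<in> V \<Longrightarrow> N (u + v) + N (u - v) = 2 * N u + 2 * N v"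
begin

definition polar :: "'v \<Rightarrow> 'v \<Rightarrow> real" where
  "polar u v = (N (u + v) - N (u - v)) / 4"

lemmas V_closed = subspace_0[OF subspace] subspace_add[OF subspace] subspace_diff[OF subspace]
  subspace_scale[OF subspace]

lemma N_zero: "N 0 = 0"
  using N_scale[OF V_closed(1), of 0] by simp

lemma N_minus: "v \<in> V \<Longrightarrow> N (- v) = N v"
  using N_scale[of v "- 1"] by simp

lemma polar_commute: "u \<in> V \<Longrightarrow> v \<in> V \<Longrightarrow> polar u v = polar v u"
  using N_minus[of "u - v"] by (simp add: polar_def V_closed add.commute)

lemma polar_self: "v \<in> V \<Longrightarrow> polar v v = N v"
  using N_scale[of v 2] scale_left_distrib[of 1 1 v] by (simp add: polar_def N_zero)

text \<open>
  The parallelogram law at \<open>p + w, q\<close> minus the one at \<open>p - w, q\<close> gives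
  \<open>polar (p + q) w + polar (p - q) w = 2 * polar p w\<close>. With \<open>p = q\<close> the right-hand side is
  \<open>polar (p + p) w\<close>, and every pair \<open>u, v\<close> has the form \<open>p + q, p - q\<close>.
\<close>

lemma polar_add_left:
  assumes "u \<in> V" "v \<in> V" "w \<in> V"
  shows "polar (u + v) w = polar u w + polar v w"
proof -
  have sum_diff: "polar (p + q) w + polar (p - q) w = 2 * polar p w" if "p \<in> V" "q \<in> V" for p q
  proof -
    have rearrange: "p + w + q = p + q + w" "p + w - q = p - q + w" "p - w + q = p + q - w" "p - w - q = p - q - w"
      by (simp_all add: algebra_simps)
    have "N (p + w + q) + N (p + w - q) = 2 * N (p + w) + 2 * N q"
      "N (p - w + q) + N (p - w - q) = 2 * N (p - w) + 2 * N q"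
      by (simp_all add: parallelogram V_closed that assms)
    then show ?thesis unfolding polar_def rearrange by argo
  qed
  have "polar 0 w = 0" by (simp add: polar_def N_minus assms)
  then have double: "polar (p + p) w = 2 * polar p w" if "p \<in> V" for p
    using sum_diff[OF that that] by simp
  define p q where "p = (1/2) \<cdot> (u + v)" and "q = (1/2) \<cdot> (u - v)"
  have in_V: "p \<in> V" "q \<in> V" by (simp_all add: p_def q_def V_closed assms)
  have half: "(1/2) \<cdot> x + (1/2) \<cdot> x = x" for x
    using scale_left_distrib[of "1/2" "1/2" x] by simp
  have "p + q = (1/2) \<cdot> u + (1/2) \<cdot> u" "p - q = (1/2) \<cdot> v + (1/2) \<cdot> v"
    unfolding p_def q_def by (simp_all add: scale_right_distrib scale_right_diff_distrib)
  then have "p + q = u" "p - q = v" by (simp_all only: half)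
  moreover have "p + p = u + v" unfolding p_def by (rule half)
  ultimately show ?thesis using sum_diff[OF in_V] double[OF in_V(1)] by simp
qed

lemma polar_scale_left:
  assumes "u \<in> V" "v \<in> V"
  shows "polar (a \<cdot> u) v = a * polar u v"
proof -
  have "\<bar>polar (r \<cdot> u) v\<bar> \<le> N u + N v" if "\<bar>r\<bar> \<le> 1" for r
  proof -
    have "0 \<le> N (r \<cdot> u + v)" "0 \<le> N (r \<cdot> u - v)" "0 \<le> N v"
      by (simp_all add: N_ge_zero V_closed assms)
    moreover have "N (r \<cdot> u + v) + N (r \<cdot> u - v) = 2 * (r\<^sup>2 * N u) + 2 * N v"
      by (simp add: parallelogram N_scale V_closed assms)
    moreover have "r\<^sup>2 * N u \<le> N u"
      using that by (intro mult_left_le_one_le) (simp_all add: N_ge_zero assms abs_square_le_1)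
    ultimately show ?thesis unfolding polar_def by simp
  qed
  then have "polar (a \<cdot> u) v = a * polar (1 \<cdot> u) v"
    by (intro additive_bounded_imp_linear[where M = "N u + N v"])
      (simp_all add: scale_left_distrib polar_add_left V_closed assms)
  then show ?thesis by simp
qed

end

section \<open>Positive semidefinite kernels\<close>

text \<open>
  A list \<open>[(a\<^sub>1, x\<^sub>1), \<dots>]\<close> stands for the formal linear combination \<open>a\<^sub>1 x\<^sub>1 + \<dots>\<close> of points. Points may
  repeat, so that addition is concatenation and no finite support has to be tracked.
\<close>

definition pairing :: "(real \<times> 'a) list \<Rightarrow> ('a \<Rightarrow> real) \<Rightarrow> real" where
  "pairing c f = (\<Sum>(a, x)\<leftarrow>c. a * f x)"

definition rescale :: "real \<Rightarrow> (real \<times> 'a) list \<Rightarrow> (real \<times> 'a) list" where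
  "rescale t c = map (\<lambda>(a, x). (t * a, x)) c"

definition form :: "('a \<Rightarrow> 'a \<Rightarrow> real) \<Rightarrow> (real \<times> 'a) list \<Rightarrow> (real \<times> 'a) list \<Rightarrow> real" where
  "form K c e = pairing c (\<lambda>x. pairing e (K x))"

definition psd_kernel :: "('a \<Rightarrow> 'a \<Rightarrow> real) \<Rightarrow> bool" where
  "psd_kernel K \<longleftrightarrow> (\<forall>x y. K x y = K y x) \<and> (\<forall>c. 0 \<le> form K c c)"

lemma pairing_Nil [simp]: "pairing [] f = 0"
  and pairing_Cons [simp]: "pairing ((a, x) # c) f = a * f x + pairing c f"
  and pairing_append [simp]: "pairing (c @ e) f = pairing c f + pairing e f"
  by (simp_all add: pairing_def)

lemma pairing_rescale [simp]: "pairing (rescale t c) f = t * pairing c f"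
  by (induction c) (auto simp: rescale_def pairing_def algebra_simps)

lemma pairing_add: "pairing c (\<lambda>x. f x + g x) = pairing c f + pairing c g"
  and pairing_diff: "pairing c (\<lambda>x. f x - g x) = pairing c f - pairing c g"
  and pairing_scale: "pairing c (\<lambda>x. t * f x) = t * pairing c f"
  by (induction c) (auto simp: pairing_def algebra_simps)

lemma pairing_tendsto:
  assumes "\<And>x. ((\<lambda>h. s h x) \<longlongrightarrow> f x) F"
  shows "((\<lambda>h. pairing c (s h)) \<longlongrightarrow> pairing c f) F"
  by (induction c) (auto simp: pairing_def intro!: tendsto_intros assms)

lemma form_Nil [simp]: "form K [] e = 0" "form K c [] = 0"
  using pairing_scale[of c 0] by (simp_all add: form_def)

lemma form_append [simp]:
  "form K (c @ e) h = form K c h + form K e h"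
  "form K h (c @ e) = form K h c + form K h e"
  by (simp_all add: form_def pairing_add)

lemma form_rescale [simp]:
  "form K (rescale t c) e = t * form K c e"
  "form K c (rescale t e) = t * form K c e"
  by (simp_all add: form_def pairing_scale)

lemma pairing_swap:
  "pairing c (\<lambda>x. pairing e (F x)) = pairing e (\<lambda>y. pairing c (\<lambda>x. F x y))"
proof (induction c)
  case Nil
  show ?case using pairing_scale[of e 0] by simp
next
  case (Cons p c)
  then show ?case by (cases p) (simp add: pairing_add pairing_scale)
qed

lemma form_commute:
  assumes "\<And>x y. K x y = K y x"
  shows "form K c e = form K e c"
proof -
  have "(\<lambda>x. K x y) = K y" for y using assms by (auto simp: fun_eq_iff)
  then show ?thesis unfolding form_def by (subst pairing_swap) simp
qed

lemma psd_kernelD: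
  assumes "psd_kernel K"
  shows "K x y = K y x" "0 \<le> form K c c" "0 \<le> K x x"
proof -
  show "K x y = K y x" "0 \<le> form K c c" using assms by (auto simp: psd_kernel_def)
  have "0 \<le> form K [(1, x)] [(1, x)]" using assms by (auto simp: psd_kernel_def)
  then show "0 \<le> K x x" by (simp add: form_def)
qed

text \<open>
  Replacing each point \<open>x\<close> by a formal combination \<open>T x\<close> extends to a linear map on formal
  combinations. Positive semidefiniteness is therefore preserved; restriction to a subset, change of
  the origin and Schur complements are all instances.
\<close>

lemma form_pullback:
  "form (\<lambda>x y. form K (T x) (T y)) c e =
    form K (concat (map (\<lambda>(a, x). rescale a (T x)) c)) (concat (map (\<lambda>(a, x). rescale a (T x)) e))"
    (is "_ = form K (?E c) (?E e)")
proof -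
  have extend: "pairing c (\<lambda>x. pairing (T x) f) = pairing (?E c) f" for f c
    by (induction c) auto
  have "form (\<lambda>x y. form K (T x) (T y)) c e =
      pairing c (\<lambda>x. pairing (T x) (\<lambda>w. pairing e (\<lambda>y. pairing (T y) (K w))))"
    unfolding form_def by (subst pairing_swap) (rule refl)
  then show ?thesis by (simp only: extend form_def)
qed

lemma psd_kernel_pullback:
  assumes K: "psd_kernel K"
  shows "psd_kernel (\<lambda>x y. form K (T x) (T y))"
  unfolding psd_kernel_def form_pullback
  using psd_kernelD(2)[OF K] form_commute[where K = K, OF psd_kernelD(1)[OF K]] by blast

section \<open>The Hilbert space of a kernel\<close>

text \<open>
  The function \<open>f\<close> belongs to the space iff pairing with \<open>f\<close> is a bounded linear functional for the
  seminorm \<open>sqrt (form K c c)\<close>, and \<open>rkhs_sq K f\<close> is then the square of its operator norm: for a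
  fixed \<open>c\<close> the supremum over its multiples \<open>t c\<close> is \<open>(pairing c f)\<^sup>2 / form K c c\<close>. In this form
  the optimisation is over all \<open>c\<close>, which makes linear substitutions possible. The value \<open>0\<close>
  outside the space makes \<open>rkhs_sq K\<close> nonnegative, even and homogeneous on all functions, so that
  the distance derived from it is nonnegative and symmetric without membership conditions.
\<close>

definition rkhs :: "('a \<Rightarrow> 'a \<Rightarrow> real) \<Rightarrow> ('a \<Rightarrow> real) set" where
  "rkhs K = {f. bdd_above (range (\<lambda>c. 2 * pairing c f - form K c c))}"

definition rkhs_sq :: "('a \<Rightarrow> 'a \<Rightarrow> real) \<Rightarrow> ('a \<Rightarrow> real) \<Rightarrow> real" where
  "rkhs_sq K f = (if f \<in> rkhs K then SUP c. 2 * pairing c f - form K c c else 0)"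

lemma rkhs_bound:
  assumes "\<And>c. 2 * pairing c f - form K c c \<le> C"
  shows "f \<in> rkhs K" "rkhs_sq K f \<le> C"
proof -
  show "f \<in> rkhs K"
    unfolding rkhs_def using assms by (auto intro!: bdd_aboveI[where M = C])
  then show "rkhs_sq K f \<le> C"
    unfolding rkhs_sq_def using assms by (auto intro: cSUP_least)
qed

lemma rkhs_sq_ge: "f \<in> rkhs K \<Longrightarrow> 2 * pairing c f - form K c c \<le> rkhs_sq K f"
  unfolding rkhs_sq_def rkhs_def by (auto intro: cSUP_upper)

lemma rkhs_sq_nonneg: "0 \<le> rkhs_sq K f"
  using rkhs_sq_ge[of f K "[]"] by (cases "f \<in> rkhs K") (auto simp: rkhs_sq_def)

abbreviation (input) fscale :: "real \<Rightarrow> ('a \<Rightarrow> real) \<Rightarrow> 'a \<Rightarrow> real" where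
  "fscale t f \<equiv> (\<lambda>x. t * f x)"

interpretation fun_vs: vector_space "fscale :: real \<Rightarrow> ('a \<Rightarrow> real) \<Rightarrow> 'a \<Rightarrow> real"
  by unfold_locales (auto simp: fun_eq_iff algebra_simps)

lemma rkhs_scale:
  assumes "psd_kernel K" "f \<in> rkhs K"
  shows "fscale t f \<in> rkhs K" "rkhs_sq K (fscale t f) \<le> t\<^sup>2 * rkhs_sq K f"
proof -
  have "2 * pairing c (fscale t f) - form K c c \<le> t\<^sup>2 * rkhs_sq K f" for c
  proof (cases "t = 0")
    case True
    then show ?thesis using psd_kernelD(2)[OF assms(1)] by (simp add: pairing_scale[of c 0, simplified])
  next
    case False
    then have "2 * pairing c (fscale t f) - form K c c =
        t\<^sup>2 * (2 * pairing (rescale (1/t) c) f - form K (rescale (1/t) c) (rescale (1/t) c))"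
      by (simp add: pairing_scale field_simps power2_eq_square)
    also have "\<dots> \<le> t\<^sup>2 * rkhs_sq K f"
      by (intro mult_left_mono rkhs_sq_ge assms) simp
    finally show ?thesis .
  qed
  then show "fscale t f \<in> rkhs K" "rkhs_sq K (fscale t f) \<le> t\<^sup>2 * rkhs_sq K f"
    by (rule rkhs_bound)+
qed

lemma rkhs_sq_scale:
  assumes K: "psd_kernel K"
  shows "rkhs_sq K (fscale t f) = t\<^sup>2 * rkhs_sq K f"
proof (cases "t = 0")
  case True
  have "2 * pairing c (fscale 0 f) - form K c c \<le> 0" for c
    using psd_kernelD(2)[OF K] by (simp add: pairing_scale[of c 0, simplified])
  then have "rkhs_sq K (fscale 0 f) \<le> 0" by (rule rkhs_bound)
  then show ?thesis using True rkhs_sq_nonneg[of K "fscale 0 f"] by simp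
next
  case False
  then have inverse: "fscale (1/t) (fscale t f) = f" by simp
  show ?thesis
  proof (cases "f \<in> rkhs K")
    case f: True
    have "rkhs_sq K (fscale (1/t) (fscale t f)) \<le> (1/t)\<^sup>2 * rkhs_sq K (fscale t f)"
      by (intro rkhs_scale K f)
    then have "t\<^sup>2 * rkhs_sq K f \<le> rkhs_sq K (fscale t f)"
      using False by (simp add: field_simps)
    then show ?thesis using rkhs_scale[OF K f, of t] by simp
  next
    case f: False
    then have "fscale t f \<notin> rkhs K"
      using rkhs_scale(1)[OF K, of "fscale t f" "1/t"] inverse by auto
    then show ?thesis using f by (simp add: rkhs_sq_def)
  qed
qed

text \<open>
  The expressions for \<open>f + g\<close> at \<open>c\<close> and for \<open>f - g\<close> at \<open>e\<close> add up to twice those for \<open>f\<close> at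
  \<open>(c + e) / 2\<close> and for \<open>g\<close> at \<open>(c - e) / 2\<close>, because the quadratic form itself obeys the
  parallelogram law. Taking \<open>c\<close> or \<open>e\<close> empty gives closure under sums and differences.
\<close>

lemma rkhs_parallelogram_le:
  assumes K: "psd_kernel K" and fg: "f \<in> rkhs K" "g \<in> rkhs K"
  shows "f + g \<in> rkhs K" "f - g \<in> rkhs K"
    "rkhs_sq K (f + g) + rkhs_sq K (f - g) \<le> 2 * rkhs_sq K f + 2 * rkhs_sq K g"
proof -
  let ?C = "2 * rkhs_sq K f + 2 * rkhs_sq K g"
  have *: "(2 * pairing c (f + g) - form K c c) + (2 * pairing e (f - g) - form K e e) \<le> ?C" for c e
  proof -
    let ?p = "rescale (1/2) (c @ e)" and ?m = "rescale (1/2) (c @ rescale (- 1) e)"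
    have "(2 * pairing c (f + g) - form K c c) + (2 * pairing e (f - g) - form K e e) =
        2 * (2 * pairing ?p f - form K ?p ?p) + 2 * (2 * pairing ?m g - form K ?m ?m)"
      by (simp add: plus_fun_def fun_diff_def pairing_add pairing_diff
          form_commute[OF psd_kernelD(1)[OF K], where c = e and e = c] field_simps)
    also have "\<dots> \<le> ?C"
      by (intro add_mono mult_left_mono rkhs_sq_ge fg) simp_all
    finally show ?thesis .
  qed
  show sum: "f + g \<in> rkhs K" using *[of _ "[]"] by (intro rkhs_bound[where C = ?C]) auto
  show diff: "f - g \<in> rkhs K" using *[of "[]"] by (intro rkhs_bound[where C = ?C]) auto
  have "rkhs_sq K (f + g) \<le> ?C - (2 * pairing e (f - g) - form K e e)" for e
    using *[of _ e] by (intro rkhs_bound) (simp add: algebra_simps)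
  then have "rkhs_sq K (f - g) \<le> ?C - rkhs_sq K (f + g)"
    by (intro rkhs_bound) (simp add: algebra_simps)
  then show "rkhs_sq K (f + g) + rkhs_sq K (f - g) \<le> ?C" by simp
qed

text \<open>
  The reverse inequality is the same inequality applied to \<open>f + g\<close> and \<open>f - g\<close>.
\<close>

lemma rkhs_parallelogram:
  assumes K: "psd_kernel K" and fg: "f \<in> rkhs K" "g \<in> rkhs K"
  shows "rkhs_sq K (f + g) + rkhs_sq K (f - g) = 2 * rkhs_sq K f + 2 * rkhs_sq K g"
proof -
  note le = rkhs_parallelogram_le[OF K]
  have "(f + g) + (f - g) = fscale 2 f" "(f + g) - (f - g) = fscale 2 g"
    by (auto simp: fun_eq_iff)
  then have "4 * rkhs_sq K f + 4 * rkhs_sq K g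
      \<le> 2 * rkhs_sq K (f + g) + 2 * rkhs_sq K (f - g)"
    using le(3)[OF le(1,2)[OF fg]] rkhs_sq_scale[OF K, of 2] by simp
  then show ?thesis using le(3)[OF fg] by simp
qed

lemma rkhs_parallelogram_norm:
  assumes K: "psd_kernel K"
  shows "parallelogram_norm fscale (rkhs K) (rkhs_sq K)"
proof
  have "0 \<in> rkhs K"
  proof (rule rkhs_bound)
    show "2 * pairing c 0 - form K c c \<le> 0" for c
      using psd_kernelD(2)[OF K, of c] pairing_scale[of c 0] by (simp add: zero_fun_def)
  qed
  then show "fun_vs.subspace (rkhs K)"
    by (auto simp: fun_vs.subspace_def rkhs_parallelogram_le[OF K] rkhs_scale[OF K])
qed (simp_all add: rkhs_sq_nonneg rkhs_sq_scale[OF K] rkhs_parallelogram[OF K])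

text \<open>
  The Cauchy-Schwarz inequality between a formal combination and a function: scaling \<open>c\<close> by \<open>t\<close> in
  the supremum bounds a quadratic polynomial in \<open>t\<close>. It makes evaluation at a point continuous, so
  convergence in norm implies pointwise convergence.
\<close>

lemma rkhs_pairing_bound:
  assumes K: "psd_kernel K" and f: "f \<in> rkhs K"
  shows "\<bar>pairing c f\<bar> \<le> sqrt (rkhs_sq K f) * sqrt (form K c c)"
proof -
  let ?n = "rkhs_sq K f" and ?p = "pairing c f" and ?q = "form K c c"
  have bound: "2 * (t * ?p) - t * (t * ?q) \<le> ?n" for t
    using rkhs_sq_ge[OF f, of "rescale t c"] by simp
  have nonneg: "0 \<le> ?n" "0 \<le> ?q" by (simp_all add: rkhs_sq_nonneg psd_kernelD(2)[OF K])
  have "?p\<^sup>2 \<le> ?n * ?q"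
  proof (cases "?q = 0")
    case True
    have "?p = 0"
    proof (rule ccontr)
      assume "?p \<noteq> 0"
      \<comment> \<open>The bound is now linear in \<open>t\<close>; this \<open>t\<close> makes its left-hand side exceed \<open>?n\<close> by one.\<close>
      then have "2 * ((?n + 1) / (2 * ?p) * ?p) = ?n + 1" by simp
      then show False using bound[of "(?n + 1) / (2 * ?p)"] True by simp
    qed
    then show ?thesis using True by simp
  next
    case False
    \<comment> \<open>The quadratic polynomial is maximal at \<open>t = ?p / ?q\<close>.\<close>
    then show ?thesis
      using bound[of "?p / ?q"] nonneg by (simp add: field_simps power2_eq_square)
  qed
  then have "sqrt (?p\<^sup>2) \<le> sqrt (?n * ?q)" by (rule real_sqrt_le_mono)
  then show ?thesis by (simp add: real_sqrt_mult)
qed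

lemma rkhs_eval_bound:
  assumes "psd_kernel K" "f \<in> rkhs K"
  shows "\<bar>f x\<bar> \<le> sqrt (rkhs_sq K f) * sqrt (K x x)"
  using rkhs_pairing_bound[OF assms, of "[(1, x)]"] by (simp add: form_def)

lemma rkhs_norm_triangle:
  assumes K: "psd_kernel K" and fg: "f \<in> rkhs K" "g \<in> rkhs K"
  shows "sqrt (rkhs_sq K (f + g)) \<le> sqrt (rkhs_sq K f) + sqrt (rkhs_sq K g)"
proof -
  let ?s = "sqrt (rkhs_sq K f) + sqrt (rkhs_sq K g)"
  have "2 * pairing c (f + g) - form K c c \<le> ?s\<^sup>2" for c
  proof -
    let ?r = "sqrt (form K c c)"
    have "pairing c (f + g) \<le> ?s * ?r"
      using rkhs_pairing_bound[OF K fg(1), of c] rkhs_pairing_bound[OF K fg(2), of c]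
      by (simp add: plus_fun_def pairing_add distrib_right)
    moreover have "form K c c = ?r\<^sup>2" using psd_kernelD(2)[OF K] by simp
    moreover have "2 * (?s * ?r) - ?r\<^sup>2 \<le> ?s\<^sup>2"
      using zero_le_power2[of "?s - ?r"] by (simp add: power2_eq_square algebra_simps)
    ultimately show ?thesis by linarith
  qed
  then have "rkhs_sq K (f + g) \<le> ?s\<^sup>2" by (rule rkhs_bound)
  then have "sqrt (rkhs_sq K (f + g)) \<le> sqrt (?s\<^sup>2)" by (rule real_sqrt_le_mono)
  then show ?thesis by (simp add: rkhs_sq_nonneg)
qed

text \<open>
  The inner product is the polar form of \<open>rkhs_sq K\<close>, written out because \<open>polar\<close> is available only
  for positive semidefinite \<open>K\<close>.
\<close>

definition rkhs_space :: "('a \<Rightarrow> 'a \<Rightarrow> real) \<Rightarrow> ('a \<Rightarrow> real) inner_structure" where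
  "rkhs_space K = \<lparr>vecs = rkhs K, vadd = (+), vzero = 0, vscale = fscale,
    vinner = (\<lambda>f g. (rkhs_sq K (f + g) - rkhs_sq K (f - g)) / 4)\<rparr>"

lemma rkhs_space_sel [simp]:
  "vecs (rkhs_space K) = rkhs K" "vadd (rkhs_space K) = (+)" "vzero (rkhs_space K) = 0"
  "vscale (rkhs_space K) = fscale"
  by (simp_all add: rkhs_space_def)

lemma vinner_rkhs_space:
  assumes "psd_kernel K"
  shows "vinner (rkhs_space K) = parallelogram_norm.polar (rkhs_sq K)"
  by (simp add: rkhs_space_def fun_eq_iff
      parallelogram_norm.polar_def[OF rkhs_parallelogram_norm[OF assms]])

lemma rkhs_space_vdist:
  assumes K: "psd_kernel K"
  shows "vdist (rkhs_space K) f g = sqrt (rkhs_sq K (f - g))"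
proof -
  define h where "h = f - g"
  have "h + h = fscale 2 h" by (simp add: fun_eq_iff)
  then have double: "rkhs_sq K (h + h) = 4 * rkhs_sq K h"
    by (simp only: rkhs_sq_scale[OF K]) simp
  have "f + fscale (- 1) g = h" by (simp add: h_def fun_eq_iff)
  then have "vdist (rkhs_space K) f g = sqrt ((rkhs_sq K (h + h) - rkhs_sq K 0) / 4)"
    by (simp add: vdist_def vnorm_def rkhs_space_def)
  also have "rkhs_sq K 0 = 0"
    using rkhs_parallelogram_norm[OF K] by (rule parallelogram_norm.N_zero)
  finally show ?thesis unfolding double h_def[symmetric] by simp
qed

lemma rkhs_real_inner_space:
  assumes K: "psd_kernel K"
  shows "real_inner_space (rkhs_space K)"
proof -
  interpret parallelogram_norm fscale "rkhs K" "rkhs_sq K"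
    using K by (rule rkhs_parallelogram_norm)
  show ?thesis
  proof (unfold_locales, unfold rkhs_space_sel vinner_rkhs_space[OF K])
    fix u assume u: "u \<in> rkhs K"
    show "\<exists>v\<in>rkhs K. u + v = 0"
      using V_closed(4)[OF u, of "- 1"] by (intro bexI[of _ "fscale (- 1) u"]) (auto simp: fun_eq_iff)
    assume "polar u u = 0"
    then show "u = 0"
      using rkhs_eval_bound[OF K u] by (simp add: polar_self u fun_eq_iff)
  next
    show "polar u v = polar v u" if "u \<in> rkhs K" "v \<in> rkhs K" for u v
      using that by (rule polar_commute)
    show "fscale a (u + v) = fscale a u + fscale a v" for a and u v :: "'a \<Rightarrow> real"
      by (simp add: fun_eq_iff algebra_simps)
    show "fscale (a + b) u = fscale a u + fscale b u" for a b and u :: "'a \<Rightarrow> real"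
      by (simp add: fun_eq_iff algebra_simps)
    show "u + v = v + u" for u v :: "'a \<Rightarrow> real"
      by (rule add.commute)
  qed (simp_all add: V_closed polar_self N_ge_zero polar_add_left polar_scale_left add.assoc)
qed


text \<open>
  Completeness: a Cauchy sequence converges pointwise, and for each \<open>c\<close> the expression
  \<open>2 * pairing c (\<sigma> n - f) - form K c c\<close> is the limit over \<open>m\<close> of the same expression with \<open>\<sigma> m\<close> in
  place of \<open>f\<close>. The Cauchy bound on these passes to the limit and then to the supremum over \<open>c\<close>.
\<close>

lemma rkhs_real_hilbert_space:
  assumes K: "psd_kernel K"
  shows "real_hilbert_space (rkhs_space K)"
proof -
  interpret parallelogram_norm fscale "rkhs K" "rkhs_sq K"
    using K by (rule rkhs_parallelogram_norm)
  interpret H: real_inner_space "rkhs_space K"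
    using K by (rule rkhs_real_inner_space)
  define d where "d f g = sqrt (rkhs_sq K (f - g))" for f g
  have vdist: "vdist (rkhs_space K) = d"
    by (simp add: fun_eq_iff d_def rkhs_space_vdist[OF K])
  interpret M: Metric_space "rkhs K" d
  proof
    show "0 \<le> d f g" for f g by (simp add: d_def rkhs_sq_nonneg)
    show "d f g = d g f" for f g
    proof -
      have "f - g = fscale (- 1) (g - f)" by (simp add: fun_eq_iff)
      then have "rkhs_sq K (f - g) = (- 1)\<^sup>2 * rkhs_sq K (g - f)"
        by (simp only: rkhs_sq_scale[OF K])
      then show ?thesis by (simp add: d_def)
    qed
    fix f g h assume f: "f \<in> rkhs K" and g: "g \<in> rkhs K" and h: "h \<in> rkhs K"
    show "d f g = 0 \<longleftrightarrow> f = g"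
    proof
      assume "d f g = 0"
      then show "f = g"
        using rkhs_eval_bound[OF K V_closed(3)[OF f g]] by (simp add: d_def fun_eq_iff)
    qed (simp add: d_def N_zero)
    have "f - h = (f - g) + (g - h)" by simp
    then show "d f h \<le> d f g + d g h"
      unfolding d_def using rkhs_norm_triangle[OF K V_closed(3)[OF f g] V_closed(3)[OF g h]] by simp
  qed
  have "\<exists>f. limitin M.mtopology \<sigma> f sequentially" if cauchy: "M.MCauchy \<sigma>" for \<sigma>
  proof -
    have in_V: "\<sigma> n \<in> rkhs K" for n using cauchy by (auto simp: M.MCauchy_def)
    have close: "\<exists>k. \<forall>m\<ge>k. \<forall>n\<ge>k. d (\<sigma> m) (\<sigma> n) < \<epsilon>" if "0 < \<epsilon>" for \<epsilon>
      using cauchy that unfolding M.MCauchy_def by meson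
    have "convergent (\<lambda>n. \<sigma> n x)" for x
    proof (intro Cauchy_convergent metric_CauchyI)
      fix \<epsilon> :: real assume "0 < \<epsilon>"
      \<comment> \<open>The added one keeps the denominator positive when \<open>K x x = 0\<close>.\<close>
      then obtain k where k: "\<And>m n. m \<ge> k \<Longrightarrow> n \<ge> k \<Longrightarrow> d (\<sigma> m) (\<sigma> n) < \<epsilon> / (sqrt (K x x) + 1)"
        using close[of "\<epsilon> / (sqrt (K x x) + 1)"] psd_kernelD(3)[OF K, of x]
        by (auto simp: add_nonneg_pos)
      have "dist (\<sigma> m x) (\<sigma> n x) < \<epsilon>" if "m \<ge> k" "n \<ge> k" for m n
      proof -
        have "dist (\<sigma> m x) (\<sigma> n x) \<le> d (\<sigma> m) (\<sigma> n) * sqrt (K x x)"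
          using rkhs_eval_bound[OF K V_closed(3)[OF in_V in_V]] by (simp add: dist_real_def d_def)
        also have "\<dots> \<le> d (\<sigma> m) (\<sigma> n) * (sqrt (K x x) + 1)"
          by (intro mult_left_mono) auto
        also have "\<dots> < \<epsilon>"
          using k[OF that] psd_kernelD(3)[OF K, of x] by (simp add: pos_less_divide_eq add_nonneg_pos)
        finally show ?thesis .
      qed
      then show "\<exists>k. \<forall>m\<ge>k. \<forall>n\<ge>k. dist (\<sigma> m x) (\<sigma> n x) < \<epsilon>" by blast
    qed
    then obtain f where f: "\<And>x. (\<lambda>n. \<sigma> n x) \<longlonglongrightarrow> f x"
      unfolding convergent_def by metis
    have limit: "\<sigma> n - f \<in> rkhs K \<and> rkhs_sq K (\<sigma> n - f) \<le> \<epsilon>\<^sup>2"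
      if "0 < \<epsilon>" "n \<ge> k" and k: "\<And>m n. m \<ge> k \<Longrightarrow> n \<ge> k \<Longrightarrow> d (\<sigma> m) (\<sigma> n) < \<epsilon>" for n k \<epsilon>
    proof -
      have "2 * pairing c (\<sigma> n - f) - form K c c \<le> \<epsilon>\<^sup>2" for c
      proof (rule tendsto_upperbound)
        show "(\<lambda>m. 2 * pairing c (\<sigma> n - \<sigma> m) - form K c c) \<longlonglongrightarrow> 2 * pairing c (\<sigma> n - f) - form K c c"
          unfolding fun_diff_def pairing_diff by (intro tendsto_intros pairing_tendsto f)
        have "2 * pairing c (\<sigma> n - \<sigma> m) - form K c c \<le> \<epsilon>\<^sup>2" if "m \<ge> k" for m
        proof -
          have "rkhs_sq K (\<sigma> n - \<sigma> m) = (d (\<sigma> n) (\<sigma> m))\<^sup>2"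
            by (simp add: d_def rkhs_sq_nonneg)
          also have "\<dots> \<le> \<epsilon>\<^sup>2"
            using k[OF \<open>n \<ge> k\<close> that] by (intro power_mono) auto
          finally show ?thesis
            using rkhs_sq_ge[OF V_closed(3)[OF in_V in_V], of c n m] by simp
        qed
        then show "\<forall>\<^sub>F m in sequentially. 2 * pairing c (\<sigma> n - \<sigma> m) - form K c c \<le> \<epsilon>\<^sup>2"
          by (auto simp: eventually_sequentially)
      qed simp
      then show ?thesis using rkhs_bound by blast
    qed
    obtain k where "\<And>m n. m \<ge> k \<Longrightarrow> n \<ge> k \<Longrightarrow> d (\<sigma> m) (\<sigma> n) < 1"
      using close[of 1] by auto
    then have "\<sigma> k - f \<in> rkhs K" using limit[of 1 k k] by simp
    then have f_in: "f \<in> rkhs K" using V_closed(3)[OF in_V, of "\<sigma> k - f" k] by simp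
    have "\<forall>\<^sub>F n in sequentially. \<sigma> n \<in> rkhs K \<and> d (\<sigma> n) f < \<epsilon>" if "0 < \<epsilon>" for \<epsilon>
    proof -
      obtain k where k: "\<And>m n. m \<ge> k \<Longrightarrow> n \<ge> k \<Longrightarrow> d (\<sigma> m) (\<sigma> n) < \<epsilon> / 2"
        using close[of "\<epsilon> / 2"] \<open>0 < \<epsilon>\<close> by auto
      have "d (\<sigma> n) f < \<epsilon>" if "n \<ge> k" for n
      proof -
        have "rkhs_sq K (\<sigma> n - f) \<le> (\<epsilon> / 2)\<^sup>2"
          using limit[of "\<epsilon> / 2" k n] k that \<open>0 < \<epsilon>\<close> by simp
        then have "d (\<sigma> n) f \<le> sqrt ((\<epsilon> / 2)\<^sup>2)"
          unfolding d_def by (rule real_sqrt_le_mono)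
        then show ?thesis using \<open>0 < \<epsilon>\<close> by simp
      qed
      then show ?thesis using in_V by (auto simp: eventually_sequentially)
    qed
    then show ?thesis using f_in by (auto simp: M.limitin_metric)
  qed
  then have "M.mcomplete" by (simp add: M.mcomplete_def)
  then show ?thesis by unfold_locales (simp add: vdist)
qed

text \<open>
  Pairing \<open>c\<close> with \<open>K x - K y\<close> is the form of \<open>c\<close> against \<open>e = x - y\<close>. By completing the square, the
  supremum defining the squared norm is attained at \<open>c = e\<close> and equals \<open>form K e e\<close>.
\<close>

lemma rkhs_feature_dist:
  assumes K: "psd_kernel K"
  shows "K x \<in> rkhs K"
    and "vdist (rkhs_space K) (K x) (K y) = sqrt (K x x + K y y - 2 * K x y)"
proof -
  have "(\<lambda>y. K y x) = K x" for x using psd_kernelD(1)[OF K] by (auto simp: fun_eq_iff)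
  then have form_eq: "pairing c (K x) = form K c [(1, x)]" for c x by (simp add: form_def)
  have expand: "2 * form K c e - form K c c = form K e e - form K (c @ rescale (- 1) e) (c @ rescale (- 1) e)"
    for c e by (simp add: form_commute[OF psd_kernelD(1)[OF K], where c = e and e = c])
  have le: "2 * form K c e - form K c c \<le> form K e e" for c e
    using psd_kernelD(2)[OF K, of "c @ rescale (- 1) e"] expand[of c e] by linarith
  show in_rkhs: "K x \<in> rkhs K" for x
    using le[of _ "[(1, x)]"] by (intro rkhs_bound) (simp add: form_eq)
  let ?e = "[(1, x), (- 1, y)]"
  have pair: "pairing c (K x - K y) = form K c ?e" for c
    using form_append(2)[of K c "[(1, x)]" "[(- 1, y)]"] form_rescale(2)[of K c "- 1" "[(1, y)]"]
    by (simp add: fun_diff_def pairing_diff form_eq rescale_def)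
  have bound: "2 * pairing c (K x - K y) - form K c c \<le> form K ?e ?e" for c
    using le[of c ?e] by (simp add: pair)
  have "form K ?e ?e \<le> rkhs_sq K (K x - K y)"
    using rkhs_sq_ge[OF rkhs_bound(1)[OF bound], of ?e] by (simp add: pair)
  then have "rkhs_sq K (K x - K y) = form K ?e ?e"
    using rkhs_bound(2)[OF bound] by simp
  also have "\<dots> = K x x + K y y - 2 * K x y"
    using psd_kernelD(1)[OF K, of y x] by (simp add: form_def)
  finally show "vdist (rkhs_space K) (K x) (K y) = sqrt (K x x + K y y - 2 * K x y)"
    by (simp add: rkhs_space_vdist[OF K])
qed


section \<open>Realising finite kernels in \<open>\<ell>\<^sub>2\<close>\<close>

text \<open>
  Otherwise the quadratic form at \<open>x + t a\<close>, which is linear in \<open>t\<close>, would become negative. In the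
  Cholesky step below this lets division by \<open>K a a = 0\<close>, which yields \<open>0\<close>, give correct values.
\<close>

lemma psd_kernel_zero_diag:
  assumes K: "psd_kernel K" and "K a a = 0"
  shows "K x a = 0"
proof (rule ccontr)
  assume nz: "K x a \<noteq> 0"
  define t where "t = - (K x x + 1) / (2 * K x a)"
  have "0 \<le> form K [(1, x), (t, a)] [(1, x), (t, a)]" by (rule psd_kernelD(2)[OF K])
  also have "\<dots> = K x x + 2 * (t * K x a)"
    using psd_kernelD(1)[OF K, of a x] assms(2) by (simp add: form_def)
  also have "2 * (t * K x a) = - (K x x + 1)" using nz by (simp add: t_def)
  finally show False by simp
qed

text \<open>
  Cholesky decomposition: the first coordinate of \<open>x\<close> is its component along \<open>a\<close>, and the other
  coordinates realise the Schur complement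
  \<open>S x y = K x y - K x a * K y a / K a a\<close> on the remaining points. \<open>S\<close> is positive semidefinite since it
  is the pullback of \<open>K\<close> under the projection \<open>x \<mapsto> x - (K x a / K a a) a\<close>.
\<close>

lemma finite_gram_realization:
  fixes K :: "'a \<Rightarrow> 'a \<Rightarrow> real"
  assumes "finite A" "psd_kernel K"
  shows "\<exists>(u :: 'a \<Rightarrow> nat \<Rightarrow> real) n. (\<forall>x. \<forall>k\<ge>n. u x k = 0) \<and>
    (\<forall>x\<in>A. \<forall>y\<in>A. (\<Sum>k<n. u x k * u y k) = K x y)"
  using assms
proof (induction A arbitrary: K rule: finite_induct)
  case empty
  show ?case by (intro exI[of _ "\<lambda>x k. 0"]) auto
next
  case (insert a A)
  note K = insert.prems
  note sym = psd_kernelD(1)[OF K, of a]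
  let ?T = "\<lambda>x. [(1, x), (- K x a / K a a, a)]"
  define S where "S x y = form K (?T x) (?T y)" for x y
  have S: "S x y = K x y - K x a * K y a / K a a" for x y
  proof -
    have "S x y = K x y - K y a / K a a * K x a - K x a / K a a * (K a y - K y a / K a a * K a a)"
      by (simp add: S_def form_def algebra_simps diff_divide_distrib)
    also have "\<dots> = K x y - K x a * K y a / K a a"
    proof (cases "K a a = 0")
      case False
      then show ?thesis by (simp add: sym[of y])
    qed simp
    finally show ?thesis .
  qed
  have "psd_kernel S" unfolding S_def using K by (rule psd_kernel_pullback)
  from insert.IH[OF this] obtain u :: "'a \<Rightarrow> nat \<Rightarrow> real" and n where
    u0: "\<forall>x. \<forall>k\<ge>n. u x k = 0" and u: "\<forall>x\<in>A. \<forall>y\<in>A. (\<Sum>k<n. u x k * u y k) = S x y"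
    by blast
  define v where "v x k = (case k of 0 \<Rightarrow> K x a / sqrt (K a a) | Suc j \<Rightarrow> if x = a then 0 else u x j)"
    for x k
  have first: "v x 0 * v y 0 = K x a * K y a / K a a" for x y
    using psd_kernelD(3)[OF K, of a] by (simp add: v_def)
  have with_a: "K x a * K a a / K a a = K x a" "K a a * K x a / K a a = K x a" for x
    using psd_kernel_zero_diag[OF K] by (cases "K a a = 0"; simp)+
  have "(\<Sum>k<Suc n. v x k * v y k) = K x y" if "x \<in> insert a A" "y \<in> insert a A" for x y
  proof -
    have "(\<Sum>k<Suc n. v x k * v y k) = K x a * K y a / K a a +
        (\<Sum>k<n. (if x = a then 0 else u x k) * (if y = a then 0 else u y k))"
      unfolding sum.lessThan_Suc_shift first by (simp add: v_def)
    also have "\<dots> = K x y"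
    proof (cases "x = a \<or> y = a")
      case True
      then show ?thesis by (auto simp: with_a sym[of y])
    next
      case False
      then have "x \<in> A" "y \<in> A" using that by auto
      then show ?thesis using u False by (simp add: S)
    qed
    finally show ?thesis .
  qed
  moreover have "v x k = 0" if "Suc n \<le> k" for x k
    using that u0 by (auto simp: v_def split: nat.split)
  ultimately show ?case by blast
qed

lemma finite_gram_ell2:
  fixes K :: "'a \<Rightarrow> 'a \<Rightarrow> real"
  assumes "finite A" "psd_kernel K"
  shows "\<exists>u\<in>A \<rightarrow> ell2. \<forall>x\<in>A. \<forall>y\<in>A. ell2_norm (u x - u y) = sqrt (K x x + K y y - 2 * K x y)"
proof -
  obtain u :: "'a \<Rightarrow> nat \<Rightarrow> real" and n where
    u0: "\<And>x k. n \<le> k \<Longrightarrow> u x k = 0" and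
    u: "\<And>x y. x \<in> A \<Longrightarrow> y \<in> A \<Longrightarrow> (\<Sum>k<n. u x k * u y k) = K x y"
    using finite_gram_realization[OF assms] by blast
  have "u x \<in> ell2" for x
    unfolding ell2_def by (intro CollectI summable_finite[of "{..<n}"]) (simp_all add: u0)
  moreover have "ell2_norm (u x - u y) = sqrt (K x x + K y y - 2 * K x y)" if "x \<in> A" "y \<in> A" for x y
  proof -
    have "(\<Sum>k. ((u x - u y) k)\<^sup>2) = (\<Sum>k<n. (u x k - u y k)\<^sup>2)"
      unfolding fun_diff_def by (rule suminf_finite) (auto simp: u0)
    also have "\<dots> = (\<Sum>k<n. u x k * u x k) + (\<Sum>k<n. u y k * u y k) - 2 * (\<Sum>k<n. u x k * u y k)"
      by (simp add: sum_distrib_left flip: sum.distrib sum_subtractf)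
        (simp add: power2_eq_square algebra_simps)
    finally show ?thesis by (simp add: ell2_norm_def u that)
  qed
  ultimately show ?thesis by blast
qed

section \<open>Gram kernels\<close>

context real_inner_space
begin

lemma inner_zero_left: "v \<in> vecs H \<Longrightarrow> vinner H (vzero H) v = 0"
  using inner_add_left[OF zero_closed zero_closed] by (simp add: add_zero zero_closed)

lemma vdist_eq_inner:
  assumes u: "u \<in> vecs H" and v: "v \<in> vecs H"
  shows "vdist H u v = sqrt (vinner H u u + vinner H v v - 2 * vinner H u v)"
proof -
  let ?v = "vscale H (- 1) v"
  let ?w = "vadd H u ?v"
  have v': "?v \<in> vecs H" and w: "?w \<in> vecs H" using u v by (simp_all add: scale_closed add_closed)
  have left: "vinner H z ?w = vinner H z u - vinner H z v" if z: "z \<in> vecs H" for z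
    using inner_commute[OF z w] inner_add_left[OF u v' z] inner_scale_left[OF v z, of "- 1"]
      inner_commute[OF u z] inner_commute[OF v z] by simp
  have "vinner H ?w ?w = vinner H u ?w - vinner H v ?w"
    using inner_add_left[OF u v' w] inner_scale_left[OF v w, of "- 1"] by simp
  then show ?thesis
    using left[OF u] left[OF v] inner_commute[OF u v] by (simp add: vdist_def vnorm_def)
qed

text \<open>
  The quadratic form at a formal combination is the squared norm of the combination evaluated in
  the space.
\<close>

lemma psd_kernel_gram:
  assumes g: "\<And>x. g x \<in> vecs H"
  shows "psd_kernel (\<lambda>x y. vinner H (g x) (g y))"
proof -
  define comb where "comb c = foldr (\<lambda>(a, x). vadd H (vscale H a (g x))) c (vzero H)" for c
  have comb: "comb c \<in> vecs H" for c
    by (induction c) (auto simp: comb_def zero_closed add_closed scale_closed g)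
  have inner_comb: "vinner H (comb c) v = pairing c (\<lambda>x. vinner H (g x) v)" if v: "v \<in> vecs H" for c v
  proof (induction c)
    case Nil
    show ?case by (simp add: comb_def inner_zero_left v)
  next
    case (Cons p c)
    have "comb (p # c) = vadd H (vscale H (fst p) (g (snd p))) (comb c)"
      by (simp add: comb_def case_prod_unfold)
    then show ?case
      using Cons.IH by (cases p) (simp add: inner_add_left inner_scale_left scale_closed g comb v)
  qed
  have "form (\<lambda>x y. vinner H (g x) (g y)) c c = vinner H (comb c) (comb c)" for c
  proof -
    have "pairing c (\<lambda>y. vinner H (g x) (g y)) = vinner H (g x) (comb c)" for x
      using inner_comb[OF g] inner_commute[OF g comb, of x c] inner_commute[OF g g, of x]
      by simp
    then show ?thesis by (simp add: form_def inner_comb[OF comb])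
  qed
  then show ?thesis
    using inner_ge_zero[OF comb] inner_commute[OF g g] by (simp add: psd_kernel_def)
qed

end

text \<open>
  The quadratic form is the sum over \<open>n\<close> of the squares of the combinations of the \<open>n\<close>-th
  coordinates.
\<close>

lemma psd_kernel_ell2:
  fixes u :: "'a \<Rightarrow> nat \<Rightarrow> real"
  assumes u: "\<And>x. u x \<in> ell2"
  defines "K \<equiv> \<lambda>x y. \<Sum>n. u x n * u y n"
  shows "psd_kernel K" and "ell2_norm (u x - u y) = sqrt (K x x + K y y - 2 * K x y)"
proof -
  have sums: "(\<lambda>n. u x n * u y n) sums K x y" for x y
  proof -
    have "summable (\<lambda>n. u x n * u y n)"
    proof (rule summable_comparison_test')
      show "summable (\<lambda>n. (u x n)\<^sup>2 + (u y n)\<^sup>2)"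
        using u by (intro summable_add) (auto simp: ell2_def)
      show "norm (u x n * u y n) \<le> (u x n)\<^sup>2 + (u y n)\<^sup>2" for n
      proof -
        have "2 * (\<bar>u x n\<bar> * \<bar>u y n\<bar>) \<le> (u x n)\<^sup>2 + (u y n)\<^sup>2"
          using sum_squares_bound[of "\<bar>u x n\<bar>" "\<bar>u y n\<bar>"] by simp
        moreover have "0 \<le> \<bar>u x n\<bar> * \<bar>u y n\<bar>" by simp
        ultimately show ?thesis unfolding real_norm_def abs_mult by linarith
      qed
    qed
    then show ?thesis by (simp add: K_def summable_sums)
  qed
  have pairing_sums: "(\<lambda>n. pairing c (s n)) sums pairing c f" if "\<And>x. (\<lambda>n. s n x) sums f x"
    for c s and f :: "'a \<Rightarrow> real"
    by (induction c) (auto simp: pairing_def intro!: sums_add sums_mult that)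
  have "(\<lambda>n. (pairing c (\<lambda>x. u x n))\<^sup>2) sums form K c c" for c
  proof -
    have "(\<lambda>n. pairing c (\<lambda>x. pairing c (\<lambda>y. u x n * u y n))) sums form K c c"
      unfolding form_def by (intro pairing_sums sums)
    moreover have "pairing c (\<lambda>x. u x n * p) = p * pairing c (\<lambda>x. u x n)" for n p
      using pairing_scale[of c p] by (simp add: mult.commute)
    ultimately show ?thesis by (simp add: pairing_scale power2_eq_square)
  qed
  then have "0 \<le> form K c c" for c
    by (rule sums_le[OF _ sums_zero, rotated]) simp
  then show "psd_kernel K" by (simp add: psd_kernel_def K_def mult.commute)
  have "(\<lambda>n. u x n * u x n + u y n * u y n - 2 * (u x n * u y n)) sums (K x x + K y y - 2 * K x y)"
    by (intro sums_add sums_diff sums_mult sums)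
  moreover have "u x n * u x n + u y n * u y n - 2 * (u x n * u y n) = ((u x - u y) n)\<^sup>2" for n
    by (simp add: power2_eq_square algebra_simps)
  ultimately show "ell2_norm (u x - u y) = sqrt (K x x + K y y - 2 * K x y)"
    by (simp add: ell2_norm_def sums_iff)
qed

section \<open>Compactness of kernels with bounded distances\<close>

text \<open>
  Distances determine a kernel only up to a translation of the points, so bounds on them do not
  confine it. Moving the point \<open>z\<close> to the origin makes \<open>K x x\<close> the squared distance from \<open>x\<close> to \<open>z\<close>, which is at most \<open>b x z\<close>; then
  \<open>\<bar>K x y\<bar> \<le> (K x x + K y y) / 2\<close> confines all kernels to one compact box.
\<close>

lemma psd_kernel_compactness:
  fixes X :: "'a set" and l b :: "'a \<Rightarrow> 'a \<Rightarrow> real"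
  assumes finite_kernels: "\<And>A. finite A \<Longrightarrow> A \<subseteq> X \<Longrightarrow> \<exists>K. psd_kernel K \<and>
    (\<forall>x\<in>A. \<forall>y\<in>A. K x x + K y y - 2 * K x y \<in> {l x y..b x y})"
  shows "\<exists>K. psd_kernel K \<and> (\<forall>x\<in>X. \<forall>y\<in>X. K x x + K y y - 2 * K x y \<in> {l x y..b x y})"
proof (cases "X = {}")
  case True
  then show ?thesis using finite_kernels[of "{}"] by auto
next
  case False
  then obtain z where z: "z \<in> X" by blast
  define R where "R = (\<lambda>(x, y). (\<bar>b x z\<bar> + \<bar>b y z\<bar>) / 2)"
  have "\<exists>k :: 'a \<times> 'a \<Rightarrow> real. psd_kernel (curry k) \<and> (\<forall>p. \<bar>k p\<bar> \<le> R p) \<and>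
      (\<forall>x\<in>A. \<forall>y\<in>A. k (x, x) + k (y, y) - 2 * k (x, y) \<in> {l x y..b x y})"
    if A: "finite A" "A \<subseteq> X" for A
  proof -
    obtain K where K: "psd_kernel K"
      and dist: "\<And>x y. x \<in> insert z A \<Longrightarrow> y \<in> insert z A \<Longrightarrow> K x x + K y y - 2 * K x y \<in> {l x y..b x y}"
    proof -
      have "finite (insert z A)" "insert z A \<subseteq> X" using A z by auto
      from finite_kernels[OF this] show ?thesis using that by blast
    qed
    \<comment> \<open>Points outside \<open>A\<close> are sent to the zero combination, so the bound holds for all pairs.\<close>
    define T where "T x = (if x \<in> A then [(1 :: real, x), (- 1, z)] else [])" for x
    define L where "L x y = form K (T x) (T y)" for x y
    have L: "psd_kernel L" unfolding L_def using K by (rule psd_kernel_pullback)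
    note sym = psd_kernelD(1)[OF K, of z]
    have diag: "L x x \<le> \<bar>b x z\<bar>" for x
      using dist[of x z] by (auto simp: L_def T_def form_def sym[of x])
    have "\<bar>L x y\<bar> \<le> R (x, y)" for x y
    proof -
      have "0 \<le> form L [(1, x), (1, y)] [(1, x), (1, y)]" "0 \<le> form L [(1, x), (- 1, y)] [(1, x), (- 1, y)]"
        by (rule psd_kernelD(2)[OF L])+
      then have "\<bar>L x y\<bar> \<le> (L x x + L y y) / 2"
        using psd_kernelD(1)[OF L, of y x] by (simp add: form_def)
      then show ?thesis using diag[of x] diag[of y] by (simp add: R_def)
    qed
    moreover have "L x x + L y y - 2 * L x y = K x x + K y y - 2 * K x y" if "x \<in> A" "y \<in> A" for x y
      using that by (simp add: L_def T_def form_def sym[of x] sym[of y])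
    ultimately show ?thesis
      using L dist by (intro exI[of _ "case_prod L"]) auto
  qed
  then obtain k :: "'a set \<Rightarrow> 'a \<times> 'a \<Rightarrow> real" where
    k_psd: "\<And>A. finite A \<Longrightarrow> A \<subseteq> X \<Longrightarrow> psd_kernel (curry (k A))" and
    k_bound: "\<And>A p. finite A \<Longrightarrow> A \<subseteq> X \<Longrightarrow> \<bar>k A p\<bar> \<le> R p" and
    k_dist: "\<And>A x y. finite A \<Longrightarrow> A \<subseteq> X \<Longrightarrow> x \<in> A \<Longrightarrow> y \<in> A \<Longrightarrow>
      k A (x, x) + k A (y, y) - 2 * k A (x, y) \<in> {l x y..b x y}"
    by metis
  \<comment> \<open>Every condition on finitely many points holds eventually along \<open>F\<close>, hence along its
    refinement \<open>G\<close> that converges to the cluster point \<open>h\<close>.\<close>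
  define F where "F = filtermap k (finite_subsets_at_top X)"
  have ev_F: "eventually P F" if "\<And>A. finite A \<Longrightarrow> A \<subseteq> X \<Longrightarrow> B \<subseteq> A \<Longrightarrow> P (k A)" "finite B" "B \<subseteq> X" for P B
    using that unfolding F_def eventually_filtermap eventually_finite_subsets_at_top by blast
  define box where "box = (PiE UNIV (\<lambda>p. {- R p..R p}) :: ('a \<times> 'a \<Rightarrow> real) set)"
  have "compactin (product_topology (\<lambda>p. euclidean) UNIV) box"
    unfolding box_def compactin_PiE by simp
  then have "compact box" by (simp add: euclidean_product_topology)
  moreover have "F \<noteq> bot" by (simp add: F_def filtermap_bot_iff)
  moreover have "eventually (\<lambda>h. h \<in> box) F"
    using k_bound by (intro ev_F[of "{}"]) (auto simp: box_def abs_le_iff minus_le_iff)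
  ultimately obtain h where cluster: "inf (nhds h) F \<noteq> bot"
    unfolding compact_filter by blast
  define G where "G = inf (nhds h) F"
  have G: "G \<noteq> bot" using cluster by (simp add: G_def)
  have ev_G: "eventually P G" if "eventually P F" for P
    using that unfolding G_def by (rule filter_leD[rotated]) simp
  have coord: "((\<lambda>g. g p) \<longlongrightarrow> h p) G" for p
  proof -
    have "((\<lambda>g. g p) \<longlongrightarrow> h p) (nhds h)"
    proof (rule topological_tendstoI)
      fix S assume S: "open S" "h p \<in> S"
      have "open ((\<lambda>g. g p) -` S)"
        using S(1) continuous_on_product_coordinates by (rule open_vimage)
      then show "\<forall>\<^sub>F g in nhds h. g p \<in> S"
        using S(2) unfolding eventually_nhds by (intro exI[of _ "(\<lambda>g. g p) -` S"]) auto
    qed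
    then show ?thesis by (rule tendsto_mono[rotated]) (simp add: G_def)
  qed
  have "psd_kernel (curry h)"
    unfolding psd_kernel_def
  proof (intro conjI allI)
    show "curry h x y = curry h y x" for x y
    proof -
      have "((\<lambda>g. g (x, y) - g (y, x)) \<longlongrightarrow> h (x, y) - h (y, x)) G"
        by (intro tendsto_intros coord)
      moreover have "\<forall>\<^sub>F g in G. g (x, y) - g (y, x) = 0"
        using psd_kernelD(1)[OF k_psd, of _ x y] by (intro ev_G ev_F[of "{}"]) auto
      ultimately have "((\<lambda>g. 0) \<longlongrightarrow> h (x, y) - h (y, x)) G"
        by (rule Lim_transform_eventually)
      then show ?thesis using tendsto_unique[OF G _ tendsto_const] by fastforce
    qed
    show "0 \<le> form (curry h) c c" for c
    proof (rule tendsto_lowerbound)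
      show "((\<lambda>g. form (curry g) c c) \<longlongrightarrow> form (curry h) c c) G"
        unfolding form_def curry_def by (intro pairing_tendsto coord)
      show "\<forall>\<^sub>F g in G. 0 \<le> form (curry g) c c"
        using psd_kernelD(2)[OF k_psd] by (intro ev_G ev_F[of "{}"]) auto
    qed (rule G)
  qed
  moreover have "curry h x x + curry h y y - 2 * curry h x y \<in> {l x y..b x y}" if "x \<in> X" "y \<in> X" for x y
  proof -
    have "((\<lambda>g. g (x, x) + g (y, y) - 2 * g (x, y)) \<longlongrightarrow> h (x, x) + h (y, y) - 2 * h (x, y)) G"
      by (intro tendsto_intros coord)
    moreover have "\<forall>\<^sub>F g in G. g (x, x) + g (y, y) - 2 * g (x, y) \<in> {l x y..b x y}"
      using k_dist that by (intro ev_G ev_F[of "{x, y}"]) auto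
    ultimately have "h (x, x) + h (y, y) - 2 * h (x, y) \<in> {l x y..b x y}"
      using G by (intro Lim_in_closed_set) auto
    then show ?thesis by simp
  qed
  ultimately show ?thesis by blast
qed

section \<open>Coarse embeddings and finite subsets\<close>

lemma hilbert_coarse_embedding_finite_ell2:
  assumes "coarsely_embeds_in_hilbert TYPE('h) X d"
  shows "\<exists>\<rho>1 \<rho>2 :: real \<Rightarrow> real.
      \<rho>1 \<in> {0..} \<rightarrow> {0..} \<and> mono_on {0..} \<rho>1 \<and>
      \<rho>2 \<in> {0..} \<rightarrow> {0..} \<and> mono_on {0..} \<rho>2 \<and>
      filterlim \<rho>1 at_top at_top \<and>
      (\<forall>A. A \<subseteq> X \<and> finite A \<longrightarrow>
        (\<exists>f \<in> A \<rightarrow> ell2. \<forall>x\<in>A. \<forall>y\<in>A.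
          \<rho>1 (d x y) \<le> ell2_norm (f x - f y) \<and> ell2_norm (f x - f y) \<le> \<rho>2 (d x y)))"
proof -
  obtain H :: "'h inner_structure" and g \<sigma>1 \<sigma>2 where "real_hilbert_space H"
    and g: "g \<in> X \<rightarrow> vecs H"
    and \<sigma>: "\<sigma>1 \<in> {0..} \<rightarrow> {0..}" "mono_on {0..} \<sigma>1" "\<sigma>2 \<in> {0..} \<rightarrow> {0..}" "mono_on {0..} \<sigma>2"
      "filterlim \<sigma>1 at_top at_top"
    and dist: "\<And>x y. x \<in> X \<Longrightarrow> y \<in> X \<Longrightarrow>
      \<sigma>1 (d x y) \<le> vdist H (g x) (g y) \<and> vdist H (g x) (g y) \<le> \<sigma>2 (d x y)"
    using assms unfolding coarsely_embeds_in_hilbert_def coarse_embedding_def by blast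
  then interpret real_hilbert_space H by simp
  \<comment> \<open>A total extension, because positive semidefiniteness concerns all points of the type.\<close>
  define g' where "g' x = (if x \<in> X then g x else vzero H)" for x
  have g': "g' x \<in> vecs H" for x using g zero_closed by (auto simp: g'_def)
  have "\<exists>f \<in> A \<rightarrow> ell2. \<forall>x\<in>A. \<forall>y\<in>A.
      \<sigma>1 (d x y) \<le> ell2_norm (f x - f y) \<and> ell2_norm (f x - f y) \<le> \<sigma>2 (d x y)"
    if A: "A \<subseteq> X" "finite A" for A
  proof -
    obtain f where "f \<in> A \<rightarrow> ell2"
      "\<forall>x\<in>A. \<forall>y\<in>A. ell2_norm (f x - f y) = vdist H (g' x) (g' y)"
      using finite_gram_ell2[OF A(2) psd_kernel_gram[where g = g', OF g']] vdist_eq_inner[OF g' g'] by auto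
    moreover have "g' x = g x" if "x \<in> A" for x using that A by (auto simp: g'_def)
    ultimately show ?thesis using dist A(1) by (intro bexI[of _ f]) (auto simp: subset_iff)
  qed
  then show ?thesis using \<sigma> by blast
qed

text \<open>
  Squaring turns the control functions into bounds for \<open>K x x + K y y - 2 * K x y\<close>, an expression
  that is linear in the kernel, which is what the compactness argument needs.
\<close>

lemma finite_ell2_hilbert_coarse_embedding:
  fixes X :: "'a set" and d :: "'a \<Rightarrow> 'a \<Rightarrow> real"
  assumes d: "\<And>x y. 0 \<le> d x y"
    and \<rho>: "\<rho>1 \<in> {0..} \<rightarrow> {0..}" "mono_on {0..} \<rho>1" "\<rho>2 \<in> {0..} \<rightarrow> {0..}" "mono_on {0..} \<rho>2"
      "filterlim \<rho>1 at_top at_top"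
    and finite_embeddings: "\<And>A. A \<subseteq> X \<Longrightarrow> finite A \<Longrightarrow> \<exists>f \<in> A \<rightarrow> ell2. \<forall>x\<in>A. \<forall>y\<in>A.
      \<rho>1 (d x y) \<le> ell2_norm (f x - f y) \<and> ell2_norm (f x - f y) \<le> \<rho>2 (d x y)"
  shows "coarsely_embeds_in_hilbert TYPE('a \<Rightarrow> real) X d"
proof -
  have nonneg: "0 \<le> \<rho>1 (d x y)" "0 \<le> \<rho>2 (d x y)" for x y
    using \<rho>(1,3) d[of x y] by (auto simp: Pi_iff)
  have "\<exists>K. psd_kernel K \<and>
      (\<forall>x\<in>A. \<forall>y\<in>A. K x x + K y y - 2 * K x y \<in> {(\<rho>1 (d x y))\<^sup>2..(\<rho>2 (d x y))\<^sup>2})"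
    if A: "finite A" "A \<subseteq> X" for A
  proof -
    obtain f where f: "f \<in> A \<rightarrow> ell2" and dist: "\<And>x y. x \<in> A \<Longrightarrow> y \<in> A \<Longrightarrow>
        \<rho>1 (d x y) \<le> ell2_norm (f x - f y) \<and> ell2_norm (f x - f y) \<le> \<rho>2 (d x y)"
      using finite_embeddings[OF A(2,1)] by blast
    define u where "u x = (if x \<in> A then f x else 0)" for x
    have u: "u x \<in> ell2" for x using f by (auto simp: u_def ell2_def)
    define K where "K x y = (\<Sum>n. u x n * u y n)" for x y
    have K: "psd_kernel K" and norm: "ell2_norm (u x - u y) = sqrt (K x x + K y y - 2 * K x y)" for x y
      unfolding K_def using psd_kernel_ell2[where u = u, OF u] by blast+
    have "K x x + K y y - 2 * K x y \<in> {(\<rho>1 (d x y))\<^sup>2..(\<rho>2 (d x y))\<^sup>2}" if "x \<in> A" "y \<in> A" for x y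
    proof -
      have "\<rho>1 (d x y) \<le> sqrt (K x x + K y y - 2 * K x y)" "sqrt (K x x + K y y - 2 * K x y) \<le> \<rho>2 (d x y)"
        using dist[OF that] that norm[of x y] by (simp_all add: u_def)
      moreover have "0 \<le> form K [(1, x), (- 1, y)] [(1, x), (- 1, y)]" by (rule psd_kernelD(2)[OF K])
      then have "0 \<le> K x x + K y y - 2 * K x y"
        using psd_kernelD(1)[OF K, of y x] by (simp add: form_def)
      ultimately show ?thesis
        using power_mono[of "\<rho>1 (d x y)" "sqrt (K x x + K y y - 2 * K x y)" 2]
          power_mono[of "sqrt (K x x + K y y - 2 * K x y)" "\<rho>2 (d x y)" 2] nonneg[of x y]
        by simp
    qed
    then show ?thesis using K by blast
  qed
  then have "\<exists>K. psd_kernel K \<and>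
      (\<forall>x\<in>X. \<forall>y\<in>X. K x x + K y y - 2 * K x y \<in> {(\<rho>1 (d x y))\<^sup>2..(\<rho>2 (d x y))\<^sup>2})"
    by (rule psd_kernel_compactness)
  then obtain K where K: "psd_kernel K" and
    dist: "\<forall>x\<in>X. \<forall>y\<in>X. K x x + K y y - 2 * K x y \<in> {(\<rho>1 (d x y))\<^sup>2..(\<rho>2 (d x y))\<^sup>2}"
    by blast
  have "\<rho>1 (d x y) \<le> vdist (rkhs_space K) (K x) (K y) \<and> vdist (rkhs_space K) (K x) (K y) \<le> \<rho>2 (d x y)"
    if "x \<in> X" "y \<in> X" for x y
    using bspec[OF bspec[OF dist that(1)] that(2)] nonneg[of x y]
    by (simp add: rkhs_feature_dist[OF K] real_le_rsqrt real_le_lsqrt)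
  then have "coarse_embedding X d (vecs (rkhs_space K)) (vdist (rkhs_space K)) K"
    unfolding coarse_embedding_def using \<rho> rkhs_feature_dist(1)[OF K] by auto
  then show ?thesis
    unfolding coarsely_embeds_in_hilbert_def using rkhs_real_hilbert_space[OF K] by blast
qed

theorem theorem3p4:
  fixes X :: "'a set" and d :: "'a \<Rightarrow> 'a \<Rightarrow> real"
  assumes "Metric_space X d"
  shows "(coarsely_embeds_in_hilbert TYPE('h) X d \<or>
          coarsely_embeds_in_hilbert TYPE('a \<Rightarrow> real) X d) \<longleftrightarrow>
    (\<exists>\<rho>1 \<rho>2 :: real \<Rightarrow> real.
      \<rho>1 \<in> {0..} \<rightarrow> {0..} \<and> mono_on {0..} \<rho>1 \<and>
      \<rho>2 \<in> {0..} \<rightarrow> {0..} \<and> mono_on {0..} \<rho>2 \<and>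
      filterlim \<rho>1 at_top at_top \<and>
      (\<forall>A. A \<subseteq> X \<and> finite A \<longrightarrow>
        (\<exists>f \<in> A \<rightarrow> ell2. \<forall>x\<in>A. \<forall>y\<in>A.
          \<rho>1 (d x y) \<le> ell2_norm (f x - f y) \<and> ell2_norm (f x - f y) \<le> \<rho>2 (d x y))))"
  (is "?embeds \<longleftrightarrow> ?finite")
proof
  assume ?embeds
  then show ?finite by (elim disjE) (rule hilbert_coarse_embedding_finite_ell2, assumption)+
next
  assume ?finite
  then obtain \<rho>1 \<rho>2 :: "real \<Rightarrow> real" where
    \<rho>: "\<rho>1 \<in> {0..} \<rightarrow> {0..}" "mono_on {0..} \<rho>1" "\<rho>2 \<in> {0..} \<rightarrow> {0..}" "mono_on {0..} \<rho>2"
      "filterlim \<rho>1 at_top at_top"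
    and finite_embeddings: "\<forall>A. A \<subseteq> X \<and> finite A \<longrightarrow> (\<exists>f \<in> A \<rightarrow> ell2. \<forall>x\<in>A. \<forall>y\<in>A.
      \<rho>1 (d x y) \<le> ell2_norm (f x - f y) \<and> ell2_norm (f x - f y) \<le> \<rho>2 (d x y))"
    by (elim exE conjE)
  have "coarsely_embeds_in_hilbert TYPE('a \<Rightarrow> real) X d"
    by (rule finite_ell2_hilbert_coarse_embedding[OF Metric_space.nonneg[OF assms] \<rho>])
      (simp add: finite_embeddings)
  then show ?embeds ..
qed

end
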